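(* Let a non-linear operator in a neural network (for example a hidden layer of an LSTM or a residual block of a ResNet) produce output elements $Z_1,Z_2,\ldots,Z_v$ (random variables), and let the fused representation be their sum $$H^{(v)}=\sum_{i=1}^v Z_i .$$ Suppose that the $Z_i$ are independent, with finite means $\mu_i=\mathrm{E}[Z_i]$ and finite variances $\sigma_i^2=\mathrm{E}[(Z_i-\mu_i)^2]$, that $s_v=\sqrt{\sum_{i=1}^v\sigma_i^2}>0$ for all large $v$, and that the output elements satisfy Lyapunov's condition: there exists $\delta>0$ such that $$\lim_{v\to\infty}\frac{1}{s_v^{2+\delta}}\sum_{i=1}^v \mathrm{E}\left[|Z_i-\mu_i|^{2+\delta}\right]=0.$$ Then the fused representation tends to follow the normal distribution with mean $\sum_{i=1}^v\mu_i$ and variance $s_v^2$, in the sense that $$\frac{H^{(v)}-\sum_{i=1}^v\mu_i}{s_v}\xrightarrow{d}\mathcal{N}(0,1)\quad\text{as } v\to\infty.$$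
   Context: Fused representations are the sums of the elements of the original representations produced by a single layer (channel-wise for a residual block). For an LSTM layer of dimension $d$ with final hidden states $h_{T,1},\ldots,h_{T,d}$ (where $T$ is the sequence length), the output elements are the $h_{T,k}$ and the fused representation is $H=\sum_{k=1}^d h_{T,k}$ (so $v=d$). For a residual block whose output on channel $k$ is a feature map $(Z_{k,i,j})$ of size $d_H\times d_W$, the fused representation on channel $k$ is $H_k=\sum_{i=1}^{d_H}\sum_{j=1}^{d_W}Z_{k,i,j}$ (so $v=d_H d_W$). Randomness comes from the data; network parameters are constants during a forward pass. The notation $\xrightarrow{d}$ denotes convergence in distribution. *)

theory Defs
  imports "HOL-Probability.Probability"
begin

text \<open>The output elements are indexed from 1, so the value of Z at 0 plays no role.\<close>

definition fused_representation :: "(nat \<Rightarrow> 'a \<Rightarrow> real) \<Rightarrow> nat \<Rightarrow> 'a \<Rightarrow> real" where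
  "fused_representation Z v \<omega> = (\<Sum>i=1..v. Z i \<omega>)"

definition elem_mean :: "'a measure \<Rightarrow> (nat \<Rightarrow> 'a \<Rightarrow> real) \<Rightarrow> nat \<Rightarrow> real" where
  "elem_mean M Z i = (\<integral>\<omega>. Z i \<omega> \<partial>M)"

definition elem_variance :: "'a measure \<Rightarrow> (nat \<Rightarrow> 'a \<Rightarrow> real) \<Rightarrow> nat \<Rightarrow> real" where
  "elem_variance M Z i = (\<integral>\<omega>. (Z i \<omega> - elem_mean M Z i)\<^sup>2 \<partial>M)"

definition fused_sd :: "'a measure \<Rightarrow> (nat \<Rightarrow> 'a \<Rightarrow> real) \<Rightarrow> nat \<Rightarrow> real" where
  "fused_sd M Z v = sqrt (\<Sum>i=1..v. elem_variance M Z i)"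

text \<open>
  The absolute central moments of order \<open>2 + \<delta>\<close> are expectations with values in \<open>[0, \<infinity>]\<close>.
  The Bochner integral would be 0 for an infinite moment and would make the condition hold
  where it should fail.
\<close>

definition lyapunov_condition :: "'a measure \<Rightarrow> (nat \<Rightarrow> 'a \<Rightarrow> real) \<Rightarrow> bool" where
  "lyapunov_condition M Z \<longleftrightarrow>
    (\<exists>\<delta>>0. (\<lambda>v. (\<Sum>i=1..v. \<integral>\<^sup>+\<omega>. ennreal (\<bar>Z i \<omega> - elem_mean M Z i\<bar> powr (2 + \<delta>)) \<partial>M)
               / ennreal (fused_sd M Z v powr (2 + \<delta>))) \<longlonglongrightarrow> 0)"

end

theory Submission imports Defs begin

text \<open>
  The characteristic function of the standardized sum is a product over the summands, and
  \<open>exp (- t\<^sup>2 / 2)\<close> is the product of the factors \<open>exp (- t\<^sup>2 \<sigma>\<^sub>i\<^sup>2 / 2)\<close>, where the \<open>\<sigma>\<^sub>i\<^sup>2\<close>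
  are the variances of the standardized summands. All factors have modulus at most 1, so the products
  differ by at most the sum of the differences of the factors. Each of these is
  estimated by splitting at \<open>\<bar>x\<bar> = \<epsilon>\<close>, where \<open>x\<^sup>2 \<le> \<epsilon>\<^sup>-\<^sup>\<delta> \<bar>x\<bar>\<^sup>2\<^sup>+\<^sup>\<delta>\<close> controls the tail. The total
  is a term that is small with \<open>\<epsilon>\<close> plus a multiple of the Lyapunov ratio, and Levy's continuity
  theorem concludes.
\<close>

section \<open>Elementary real inequalities\<close>

lemma exp_minus_quadratic_error:
  fixes a :: real
  assumes "a \<ge> 0"
  shows "\<bar>(1 - a) - exp (- a)\<bar> \<le> a\<^sup>2 / 2"
proof -
  have pos: "1 + a + a\<^sup>2 / 2 > 0"
    using assms by (simp add: add_pos_nonneg)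
  \<comment> \<open>The product is
    \<open>(1 + a\<^sup>2 / 2)\<^sup>2 - a\<^sup>2 = 1 + a ^ 4 / 4\<close>. This turns the quadratic
    lower bound for \<open>exp a\<close> into a quadratic upper bound for
    \<open>exp (- a)\<close>.\<close>
  have "1 \<le> (1 - a + a\<^sup>2 / 2) * (1 + a + a\<^sup>2 / 2)"
    using assms by (simp add: algebra_simps power2_eq_square)
  then have "inverse (1 + a + a\<^sup>2 / 2) \<le> 1 - a + a\<^sup>2 / 2"
    using pos by (simp add: inverse_eq_divide divide_le_eq)
  moreover have "exp (- a) \<le> inverse (1 + a + a\<^sup>2 / 2)"
    unfolding exp_minus using exp_lower_Taylor_quadratic[OF assms] pos by (intro le_imp_inverse_le)
  moreover have "1 - a \<le> exp (- a)"
    using exp_ge_add_one_self[of "- a"] by simp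
  ultimately show ?thesis
    by linarith
qed

lemma power2_le_powr_tail:
  fixes x \<delta> \<epsilon> :: real
  assumes "\<delta> > 0" "\<epsilon> > 0" "\<bar>x\<bar> > \<epsilon>"
  shows "x\<^sup>2 \<le> \<epsilon> powr (- \<delta>) * \<bar>x\<bar> powr (2 + \<delta>)"
proof -
  have "1 \<le> (\<bar>x\<bar> / \<epsilon>) powr \<delta>"
    using assms by (intro ge_one_powr_ge_zero) auto
  also have "\<dots> = \<epsilon> powr (- \<delta>) * \<bar>x\<bar> powr \<delta>"
    using assms by (simp add: powr_divide powr_minus_divide)
  finally have "\<bar>x\<bar> powr 2 * 1 \<le> \<bar>x\<bar> powr 2 * (\<epsilon> powr (- \<delta>) * \<bar>x\<bar> powr \<delta>)"
    by (intro mult_left_mono) auto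
  moreover have "\<bar>x\<bar> powr 2 = x\<^sup>2"
    using assms by simp
  ultimately show ?thesis
    by (simp add: powr_add mult_ac)
qed

section \<open>Error bounds for characteristic functions\<close>

context prob_space
begin

text \<open>The small-value part of \<open>?A\<close> carries the factor \<open>\<sigma>2\<close>,
  so that summing over normalized variables leaves it of order \<epsilon>, however many there are.
  \<open>?B\<close> serves to show that no single variance is large compared with the total.\<close>

lemma char_lyapunov_bound:
  fixes X :: "'a \<Rightarrow> real"
  assumes [measurable]: "random_variable borel X"
    and X1: "integrable M X" "expectation X = 0" and X2: "integrable M (\<lambda>\<omega>. (X \<omega>)\<^sup>2)"
    and Xd: "integrable M (\<lambda>\<omega>. \<bar>X \<omega>\<bar> powr (2 + \<delta>))"
    and "\<delta> > 0" "\<epsilon> > 0"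
  defines "\<sigma>2 \<equiv> expectation (\<lambda>\<omega>. (X \<omega>)\<^sup>2)"
    and "m \<equiv> expectation (\<lambda>\<omega>. \<bar>X \<omega>\<bar> powr (2 + \<delta>))"
  shows "cmod (char (distr M borel X) t - (1 - t\<^sup>2 * \<sigma>2 / 2))
           \<le> t\<^sup>2 / 6 * (\<epsilon> * \<bar>t\<bar> * \<sigma>2 + 6 * \<epsilon> powr (- \<delta>) * m)" (is ?A)
    and "\<sigma>2 \<le> \<epsilon>\<^sup>2 + \<epsilon> powr (- \<delta>) * m" (is ?B)
proof -
  note tail = power2_le_powr_tail[OF \<open>\<delta> > 0\<close> \<open>\<epsilon> > 0\<close>]
  \<comment> \<open>The minimum allows a different bound on each side of the split: the quadratic
    one where \<open>\<bar>x\<bar> > \<epsilon>\<close>, the cubic one elsewhere, where one factor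
    \<open>\<bar>x\<bar>\<close> is at most \<epsilon>.\<close>
  have pointwise: "min (6 * x\<^sup>2) (\<bar>t\<bar> * \<bar>x\<bar> ^ 3)
      \<le> \<epsilon> * \<bar>t\<bar> * x\<^sup>2 + 6 * \<epsilon> powr (- \<delta>) * \<bar>x\<bar> powr (2 + \<delta>)" for x
  proof (cases "\<bar>x\<bar> > \<epsilon>")
    case True
    then show ?thesis
      using tail[OF True] \<open>\<epsilon> > 0\<close> by (intro min.coboundedI1) (simp add: add_increasing)
  next
    case False
    then have "\<bar>x\<bar> * (\<bar>t\<bar> * x\<^sup>2) \<le> \<epsilon> * (\<bar>t\<bar> * x\<^sup>2)"
      by (intro mult_right_mono) auto
    moreover have "\<bar>t\<bar> * \<bar>x\<bar> ^ 3 = \<bar>x\<bar> * (\<bar>t\<bar> * x\<^sup>2)"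
      by (simp add: power3_eq_cube power2_eq_square mult_ac)
    ultimately show ?thesis
      by (intro min.coboundedI2 add_increasing2) (auto simp: mult_ac)
  qed
  \<comment> \<open>For \<delta> < 1 the third moment may be infinite; integrability of the minimum
    comes from domination by \<open>6 * x\<^sup>2\<close>.\<close>
  have abs_min: "\<bar>min (6 * x\<^sup>2) (\<bar>t\<bar> * \<bar>x\<bar> ^ 3)\<bar> \<le> \<bar>6 * x\<^sup>2\<bar>" for x
  proof -
    have "0 \<le> min (6 * x\<^sup>2) (\<bar>t\<bar> * \<bar>x\<bar> ^ 3)"
      by (intro min.boundedI) auto
    then show ?thesis
      by (simp add: abs_of_nonneg)
  qed
  have "integrable M (\<lambda>\<omega>. 6 * (X \<omega>)\<^sup>2)"
    using X2 by simp
  then have int_min: "integrable M (\<lambda>\<omega>. min (6 * (X \<omega>)\<^sup>2) (\<bar>t\<bar> * \<bar>X \<omega>\<bar> ^ 3))"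
    by (rule Bochner_Integration.integrable_bound) (simp_all only: real_norm_def abs_min, simp_all)
  have "cmod (char (distr M borel X) t - (1 - t\<^sup>2 * \<sigma>2 / 2))
      \<le> t\<^sup>2 / 6 * expectation (\<lambda>\<omega>. min (6 * (X \<omega>)\<^sup>2) (\<bar>t\<bar> * \<bar>X \<omega>\<bar> ^ 3))"
    using X1 X2 by (intro char_approx3') (auto simp: \<sigma>2_def)
  also have "\<dots> \<le> t\<^sup>2 / 6 *
      expectation (\<lambda>\<omega>. \<epsilon> * \<bar>t\<bar> * (X \<omega>)\<^sup>2 + 6 * \<epsilon> powr (- \<delta>) * \<bar>X \<omega>\<bar> powr (2 + \<delta>))"
    by (intro mult_left_mono integral_mono int_min pointwise Bochner_Integration.integrable_add
        integrable_mult_right X2 Xd) simp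
  also have "expectation (\<lambda>\<omega>. \<epsilon> * \<bar>t\<bar> * (X \<omega>)\<^sup>2 + 6 * \<epsilon> powr (- \<delta>) * \<bar>X \<omega>\<bar> powr (2 + \<delta>))
      = \<epsilon> * \<bar>t\<bar> * \<sigma>2 + 6 * \<epsilon> powr (- \<delta>) * m"
    using X2 Xd by (simp add: \<sigma>2_def m_def)
  finally show ?A .
  have "x\<^sup>2 \<le> \<epsilon>\<^sup>2 + \<epsilon> powr (- \<delta>) * \<bar>x\<bar> powr (2 + \<delta>)" for x
  proof (cases "\<bar>x\<bar> > \<epsilon>")
    case True
    then show ?thesis
      using tail[OF True] by (simp add: add_increasing)
  next
    case False
    then have "x\<^sup>2 \<le> \<epsilon>\<^sup>2"
      using \<open>\<epsilon> > 0\<close> by (intro power2_le_iff_abs_le[THEN iffD2]) auto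
    then show ?thesis
      by (simp add: add_increasing2)
  qed
  then have "\<sigma>2 \<le> expectation (\<lambda>\<omega>. \<epsilon>\<^sup>2 + \<epsilon> powr (- \<delta>) * \<bar>X \<omega>\<bar> powr (2 + \<delta>))"
    unfolding \<sigma>2_def using X2 Xd by (intro integral_mono) auto
  also have "\<dots> = \<epsilon>\<^sup>2 + \<epsilon> powr (- \<delta>) * m"
    using Xd by (simp add: m_def prob_space)
  finally show ?B .
qed

text \<open>The first part of the bound sums the Taylor errors of the characteristic functions. The
  second sums the errors of replacing \<open>1 - a i\<close> by \<open>exp (- a i)\<close>, which
  are quadratic in the variances.\<close>

lemma char_sum_lyapunov_bound:
  fixes X :: "'i \<Rightarrow> 'a \<Rightarrow> real"
  assumes "finite A" and indep: "indep_vars (\<lambda>_. borel) X A"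
    and X1: "\<And>i. i \<in> A \<Longrightarrow> integrable M (X i)" "\<And>i. i \<in> A \<Longrightarrow> expectation (X i) = 0"
    and X2: "\<And>i. i \<in> A \<Longrightarrow> integrable M (\<lambda>\<omega>. (X i \<omega>)\<^sup>2)"
    and var: "(\<Sum>i\<in>A. expectation (\<lambda>\<omega>. (X i \<omega>)\<^sup>2)) = 1"
    and Xd: "\<And>i. i \<in> A \<Longrightarrow> integrable M (\<lambda>\<omega>. \<bar>X i \<omega>\<bar> powr (2 + \<delta>))"
    and "\<delta> > 0" "\<epsilon> > 0"
  defines "L \<equiv> \<Sum>i\<in>A. expectation (\<lambda>\<omega>. \<bar>X i \<omega>\<bar> powr (2 + \<delta>))"
  shows "cmod (char (distr M borel (\<lambda>\<omega>. \<Sum>i\<in>A. X i \<omega>)) t - exp (- t\<^sup>2 / 2))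
    \<le> t\<^sup>2 / 6 * (\<epsilon> * \<bar>t\<bar> + 6 * \<epsilon> powr (- \<delta>) * L) + t ^ 4 / 8 * (\<epsilon>\<^sup>2 + \<epsilon> powr (- \<delta>) * L)"
proof -
  define s where "s i = expectation (\<lambda>\<omega>. (X i \<omega>)\<^sup>2)" for i
  define m where "m i = expectation (\<lambda>\<omega>. \<bar>X i \<omega>\<bar> powr (2 + \<delta>))" for i
  define a where "a i = t\<^sup>2 * s i / 2" for i
  define \<psi> where "\<psi> i = char (distr M borel (X i)) t" for i
  have rv [measurable]: "random_variable borel (X i)" if "i \<in> A" for i
    using indep that unfolding indep_vars_def by auto
  have s0: "s i \<ge> 0" and m0: "m i \<ge> 0" and a0: "a i \<ge> 0" for i
    by (auto simp: s_def m_def a_def)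
  have sum_s: "(\<Sum>i\<in>A. s i) = 1"
    using var by (simp add: s_def)
  have sum_m: "(\<Sum>i\<in>A. m i) = L"
    by (simp add: L_def m_def)
  have "(\<Prod>i\<in>A. exp (- a i)) = exp (- (\<Sum>i\<in>A. a i))"
    using \<open>finite A\<close> by (simp add: exp_sum sum_negf[symmetric])
  also have "(\<Sum>i\<in>A. a i) = t\<^sup>2 / 2"
    by (simp add: a_def sum_distrib_left[symmetric] sum_divide_distrib[symmetric] sum_s)
  finally have prod_exp: "(\<Prod>i\<in>A. complex_of_real (exp (- a i))) = exp (- t\<^sup>2 / 2)"
    by (simp flip: of_real_prod)
  \<comment> \<open>In the squared variance one factor \<open>s i\<close> is kept, since these sum
    to 1; the other is estimated uniformly in \<open>i\<close> by replacing \<open>m i\<close> with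
    the total \<open>L\<close>.\<close>
  have term_bound: "cmod (\<psi> i - exp (- a i))
      \<le> t\<^sup>2 / 6 * (\<epsilon> * \<bar>t\<bar> * s i + 6 * \<epsilon> powr (- \<delta>) * m i)
        + t ^ 4 / 8 * (s i * (\<epsilon>\<^sup>2 + \<epsilon> powr (- \<delta>) * L))" if "i \<in> A" for i
  proof -
    note bound = char_lyapunov_bound[OF rv X1 X2 Xd \<open>\<delta> > 0\<close> \<open>\<epsilon> > 0\<close>, OF that that that that that,
        folded s_def m_def]
    have "m i \<le> L"
      unfolding sum_m[symmetric] using \<open>finite A\<close> that m0 by (intro member_le_sum) auto
    then have "s i \<le> \<epsilon>\<^sup>2 + \<epsilon> powr (- \<delta>) * L"
      using bound(2) by (smt (verit) mult_left_mono powr_ge_zero)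
    then have "s i * s i \<le> s i * (\<epsilon>\<^sup>2 + \<epsilon> powr (- \<delta>) * L)"
      using s0 by (rule mult_left_mono)
    then have "t ^ 4 / 8 * (s i * s i) \<le> t ^ 4 / 8 * (s i * (\<epsilon>\<^sup>2 + \<epsilon> powr (- \<delta>) * L))"
      by (rule mult_left_mono) simp
    moreover have "(a i)\<^sup>2 / 2 = t ^ 4 / 8 * (s i * s i)"
      by (simp add: a_def power2_eq_square power4_eq_xxxx)
    moreover have "cmod ((1 - a i) - exp (- a i)) \<le> (a i)\<^sup>2 / 2"
      using exp_minus_quadratic_error[OF a0[of i]]
      by (simp only: norm_of_real)
    \<comment> \<open>The two approximations meet at the common second-order value
      \<open>1 - a i\<close>.\<close>
    moreover have "cmod (\<psi> i - exp (- a i))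
        \<le> cmod (\<psi> i - (1 - a i)) + cmod ((1 - a i) - exp (- a i))"
      using norm_triangle_ineq[of "\<psi> i - (1 - a i)" "complex_of_real ((1 - a i) - exp (- a i))"]
      by simp
    moreover have "cmod (\<psi> i - (1 - a i)) \<le> t\<^sup>2 / 6 * (\<epsilon> * \<bar>t\<bar> * s i + 6 * \<epsilon> powr (- \<delta>) * m i)"
      using bound(1)[of t] by (simp add: a_def \<psi>_def)
    ultimately show ?thesis
      by linarith
  qed
  have "char (distr M borel (\<lambda>\<omega>. \<Sum>i\<in>A. X i \<omega>)) t = (\<Prod>i\<in>A. \<psi> i)"
    unfolding \<psi>_def by (rule char_distr_sum[OF indep])
  then have "cmod (char (distr M borel (\<lambda>\<omega>. \<Sum>i\<in>A. X i \<omega>)) t - exp (- t\<^sup>2 / 2))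
      = cmod ((\<Prod>i\<in>A. \<psi> i) - (\<Prod>i\<in>A. complex_of_real (exp (- a i))))"
    by (simp only: prod_exp)
  also have "\<dots> \<le> (\<Sum>i\<in>A. cmod (\<psi> i - exp (- a i)))"
  proof (rule norm_prod_diff)
    show "cmod (\<psi> i) \<le> 1" if "i \<in> A" for i
      unfolding \<psi>_def
      by (intro real_distribution.cmod_char_le_1 real_distribution_distr rv that)
    show "cmod (complex_of_real (exp (- a i))) \<le> 1" for i
      using a0[of i] by simp
  qed
  also have "\<dots> \<le> (\<Sum>i\<in>A. t\<^sup>2 / 6 * (\<epsilon> * \<bar>t\<bar> * s i + 6 * \<epsilon> powr (- \<delta>) * m i)
        + t ^ 4 / 8 * (s i * (\<epsilon>\<^sup>2 + \<epsilon> powr (- \<delta>) * L)))"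
    by (intro sum_mono term_bound)
  also have "\<dots> = t\<^sup>2 / 6 * (\<epsilon> * \<bar>t\<bar> + 6 * \<epsilon> powr (- \<delta>) * L)
      + t ^ 4 / 8 * (\<epsilon>\<^sup>2 + \<epsilon> powr (- \<delta>) * L)"
    by (simp only: sum.distrib sum_distrib_left[symmetric] sum_distrib_right[symmetric]
        sum_s sum_m mult_1 mult_1_right)
  finally show ?thesis .
qed

end

section \<open>Passage to the limit\<close>

lemma lyapunov_bound_tendsto:
  fixes E L :: "nat \<Rightarrow> real" and t \<delta> :: real
  assumes L: "L \<longlonglongrightarrow> 0"
    and bound: "\<And>\<epsilon>. \<epsilon> > 0 \<Longrightarrow> \<forall>\<^sub>F v in sequentially.
      E v \<le> t\<^sup>2 / 6 * (\<epsilon> * \<bar>t\<bar> + 6 * \<epsilon> powr (- \<delta>) * L v) + t ^ 4 / 8 * (\<epsilon>\<^sup>2 + \<epsilon> powr (- \<delta>) * L v)"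
    and "\<And>v. E v \<ge> 0"
  shows "E \<longlonglongrightarrow> 0"
proof (rule order_tendstoI)
  fix e :: real
  assume "e > 0"
  \<comment> \<open>\<open>G \<epsilon>\<close> is the value of the bound at \<open>L v = 0\<close>.
    The order of choices matters: \<epsilon> is fixed first with \<open>G \<epsilon> < e\<close>,
    and only then does \<open>v\<close> grow, because the factor
    \<open>\<epsilon> powr (- \<delta>)\<close> blows up as \<epsilon> tends to 0.\<close>
  define G where "G \<epsilon> = t\<^sup>2 / 6 * (\<epsilon> * \<bar>t\<bar>) + t ^ 4 / 8 * \<epsilon>\<^sup>2" for \<epsilon>
  have "(G \<longlongrightarrow> t\<^sup>2 / 6 * (0 * \<bar>t\<bar>) + t ^ 4 / 8 * 0\<^sup>2) (at_right 0)"
    unfolding G_def by (intro tendsto_intros)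
  then have "(G \<longlongrightarrow> 0) (at_right 0)"
    by simp
  from order_tendstoD(2)[OF this \<open>e > 0\<close>] eventually_at_right_less
  obtain \<epsilon> where \<epsilon>: "G \<epsilon> < e" "\<epsilon> > 0"
    by (metis (no_types, lifting) eventually_conj eventually_happens' trivial_limit_at_right_real)
  have "(\<lambda>v. t\<^sup>2 / 6 * (\<epsilon> * \<bar>t\<bar> + 6 * \<epsilon> powr (- \<delta>) * L v) + t ^ 4 / 8 * (\<epsilon>\<^sup>2 + \<epsilon> powr (- \<delta>) * L v))
      \<longlonglongrightarrow> t\<^sup>2 / 6 * (\<epsilon> * \<bar>t\<bar> + 6 * \<epsilon> powr (- \<delta>) * 0) + t ^ 4 / 8 * (\<epsilon>\<^sup>2 + \<epsilon> powr (- \<delta>) * 0)"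
    by (intro tendsto_intros L)
  from order_tendstoD(2)[OF this, of e] \<epsilon>(1) bound[OF \<epsilon>(2)]
  show "\<forall>\<^sub>F v in sequentially. E v < e"
    by (auto simp: G_def elim: eventually_elim2)
next
  fix e :: real
  assume "e < 0"
  then show "\<forall>\<^sub>F v in sequentially. e < E v"
    using assms(3) by (auto intro!: always_eventually intro: less_le_trans)
qed

section \<open>Normal limit of the fused representation\<close>

theorem proposition2:
  fixes M :: "'a measure" and Z :: "nat \<Rightarrow> 'a \<Rightarrow> real"
  assumes "prob_space M"
    and "prob_space.indep_vars M (\<lambda>_. borel) Z {1..}"
    and "\<And>i. i \<ge> 1 \<Longrightarrow> integrable M (Z i)"
    and "\<And>i. i \<ge> 1 \<Longrightarrow> integrable M (\<lambda>\<omega>. (Z i \<omega> - elem_mean M Z i)\<^sup>2)"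
    and "\<forall>\<^sub>F v in sequentially. fused_sd M Z v > 0"
    and "lyapunov_condition M Z"
  shows "weak_conv_m
           (\<lambda>v. distr M borel
             (\<lambda>\<omega>. (fused_representation Z v \<omega> - (\<Sum>i=1..v. elem_mean M Z i)) / fused_sd M Z v))
           std_normal_distribution"
proof -
  interpret prob_space M by fact
  define Y where "Y i \<omega> = Z i \<omega> - elem_mean M Z i" for i \<omega>
  define s where "s v = fused_sd M Z v" for v
  obtain \<delta> where "\<delta> > 0" and lyap: "(\<lambda>v. (\<Sum>i=1..v. \<integral>\<^sup>+\<omega>. ennreal (\<bar>Y i \<omega>\<bar> powr (2 + \<delta>)) \<partial>M)
               / ennreal (s v powr (2 + \<delta>))) \<longlonglongrightarrow> 0"
    using assms(6) unfolding lyapunov_condition_def Y_def s_def by blast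
  have rv [measurable]: "random_variable borel (Z i)" if "i \<ge> 1" for i
    using assms(2) that unfolding indep_vars_def by auto
  have rvY [measurable]: "random_variable borel (Y i)" if "i \<ge> 1" for i
    unfolding Y_def using rv[OF that] by simp
  have s_pos: "\<forall>\<^sub>F v in sequentially. s v > 0"
    using assms(5) by (simp add: s_def)
  \<comment> \<open>Finiteness of each moment is extracted from the Lyapunov condition: an infinite
    numerator over a finite denominator would make the ratio infinite, yet the ratio is eventually
    below 1. Choosing \<open>v \<ge> i\<close> puts the \<open>i\<close>-th moment among the
    summands.\<close>
  have Yd: "integrable M (\<lambda>\<omega>. \<bar>Y i \<omega>\<bar> powr (2 + \<delta>))" if "i \<ge> 1" for i
  proof -
    have "\<forall>\<^sub>F v in sequentially. (\<Sum>i=1..v. \<integral>\<^sup>+\<omega>. ennreal (\<bar>Y i \<omega>\<bar> powr (2 + \<delta>)) \<partial>M)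
               / ennreal (s v powr (2 + \<delta>)) < 1 \<and> i \<le> v"
      using order_tendstoD(2)[OF lyap, of 1] eventually_ge_at_top[of i] by (auto intro: eventually_conj)
    then obtain v where v: "(\<Sum>i=1..v. \<integral>\<^sup>+\<omega>. ennreal (\<bar>Y i \<omega>\<bar> powr (2 + \<delta>)) \<partial>M)
               / ennreal (s v powr (2 + \<delta>)) < 1" "i \<le> v"
      using eventually_happens' sequentially_bot by blast
    have "(\<Sum>i=1..v. \<integral>\<^sup>+\<omega>. ennreal (\<bar>Y i \<omega>\<bar> powr (2 + \<delta>)) \<partial>M) \<noteq> \<top>"
    proof
      assume "(\<Sum>i=1..v. \<integral>\<^sup>+\<omega>. ennreal (\<bar>Y i \<omega>\<bar> powr (2 + \<delta>)) \<partial>M) = \<top>"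
      with v(1) show False
        by (simp only: ennreal_top_divide) simp
    qed
    then have "(\<integral>\<^sup>+\<omega>. ennreal (\<bar>Y i \<omega>\<bar> powr (2 + \<delta>)) \<partial>M) < \<infinity>"
      using that v(2) by (simp add: less_top[symmetric])
    then show ?thesis
      using rvY[OF that] by (intro integrableI_nonneg) auto
  qed
  define m where "m i = expectation (\<lambda>\<omega>. \<bar>Y i \<omega>\<bar> powr (2 + \<delta>))" for i
  define L where "L v = (\<Sum>i=1..v. m i) / s v powr (2 + \<delta>)" for v
  have m0: "m i \<ge> 0" for i
    by (simp add: m_def)
  \<comment> \<open>Once the moments are finite and \<open>s v\<close> is positive, the extended
    quotient is the real number \<open>L v\<close>, so the limit transfers to the reals.\<close>
  have "\<forall>\<^sub>F v in sequentially. (\<Sum>i=1..v. \<integral>\<^sup>+\<omega>. ennreal (\<bar>Y i \<omega>\<bar> powr (2 + \<delta>)) \<partial>M)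
               / ennreal (s v powr (2 + \<delta>)) = ennreal (L v)"
    using s_pos
  proof eventually_elim
    case (elim v)
    have "(\<Sum>i=1..v. \<integral>\<^sup>+\<omega>. ennreal (\<bar>Y i \<omega>\<bar> powr (2 + \<delta>)) \<partial>M) = (\<Sum>i=1..v. ennreal (m i))"
      unfolding m_def using Yd by (intro sum.cong nn_integral_eq_integral) auto
    then show ?case
      using elim m0 by (simp add: L_def sum_ennreal sum_nonneg divide_ennreal)
  qed
  from Lim_transform_eventually[OF lyap this] have "(\<lambda>v. ennreal (L v)) \<longlonglongrightarrow> ennreal 0"
    by simp
  then have L: "L \<longlonglongrightarrow> 0"
    by (rule tendsto_ennrealD) (auto simp: L_def m0 sum_nonneg)
  define S where
    "S v \<omega> = (fused_representation Z v \<omega> - (\<Sum>i=1..v. elem_mean M Z i)) / fused_sd M Z v" for v \<omega>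
  have S_eq: "S v = (\<lambda>\<omega>. \<Sum>i=1..v. Y i \<omega> / s v)" for v
    by (rule ext) (simp add: S_def fused_representation_def Y_def s_def sum_subtractf sum_divide_distrib[symmetric])
  have bound: "cmod (char (distr M borel (S v)) t - exp (- t\<^sup>2 / 2))
      \<le> t\<^sup>2 / 6 * (\<epsilon> * \<bar>t\<bar> + 6 * \<epsilon> powr (- \<delta>) * L v) + t ^ 4 / 8 * (\<epsilon>\<^sup>2 + \<epsilon> powr (- \<delta>) * L v)"
    if sv: "s v > 0" and "\<epsilon> > 0" for v t \<epsilon>
  proof -
    define X where "X i \<omega> = Y i \<omega> / s v" for i \<omega>
    have indep: "indep_vars (\<lambda>_. borel) X {1..v}"
      unfolding X_def Y_def
      by (rule indep_vars_compose2[OF indep_vars_subset[OF assms(2)]]) auto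
    have X1: "integrable M (X i)" "expectation (X i) = 0" if "i \<in> {1..v}" for i
      using assms(3)[of i] that by (auto simp: X_def[abs_def] Y_def[abs_def] elem_mean_def prob_space)
    have X2: "integrable M (\<lambda>\<omega>. (X i \<omega>)\<^sup>2)" if "i \<in> {1..v}" for i
      using assms(4)[of i] that by (auto simp: X_def Y_def power_divide)
    \<comment> \<open>By this homogeneity the moments of order \<open>2 + \<delta>\<close> of the
      standardized summands add up to exactly the Lyapunov ratio \<open>L v\<close>.\<close>
    have pw: "\<bar>X i \<omega>\<bar> powr (2 + \<delta>) = \<bar>Y i \<omega>\<bar> powr (2 + \<delta>) / s v powr (2 + \<delta>)" for i \<omega>
      using sv by (simp add: X_def powr_divide)
    have Xd: "integrable M (\<lambda>\<omega>. \<bar>X i \<omega>\<bar> powr (2 + \<delta>))" if "i \<in> {1..v}" for i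
      using Yd[of i] that by (simp add: pw)
    have "(\<Sum>i=1..v. elem_variance M Z i) = (s v)\<^sup>2"
      by (simp add: s_def fused_sd_def elem_variance_def sum_nonneg)
    then have var: "(\<Sum>i\<in>{1..v}. expectation (\<lambda>\<omega>. (X i \<omega>)\<^sup>2)) = 1"
      using sv by (simp add: X_def Y_def power_divide elem_variance_def sum_divide_distrib[symmetric])
    have LX: "(\<Sum>i\<in>{1..v}. expectation (\<lambda>\<omega>. \<bar>X i \<omega>\<bar> powr (2 + \<delta>))) = L v"
      by (simp add: pw L_def m_def sum_divide_distrib)
    show ?thesis
      using char_sum_lyapunov_bound[OF _ indep X1 X2 var Xd \<open>\<delta> > 0\<close> \<open>\<epsilon> > 0\<close>, of t]
      unfolding LX by (simp add: S_eq X_def)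
  qed
  have "weak_conv_m (\<lambda>v. distr M borel (S v)) std_normal_distribution"
  proof (rule levy_continuity)
    \<comment> \<open>This is required for every \<open>v\<close>, including those with
      \<open>s v = 0\<close>; there division by zero makes \<open>S v\<close> constantly 0, which is
      still measurable.\<close>
    show "real_distribution (distr M borel (S v))" for v
      unfolding S_eq by (intro real_distribution_distr) (auto intro!: borel_measurable_sum borel_measurable_divide rvY)
    fix t
    have "(\<lambda>v. cmod (char (distr M borel (S v)) t - exp (- t\<^sup>2 / 2))) \<longlonglongrightarrow> 0"
    proof (rule lyapunov_bound_tendsto[OF L])
      fix \<epsilon> :: real
      assume "\<epsilon> > 0"
      with bound show "\<forall>\<^sub>F v in sequentially. cmod (char (distr M borel (S v)) t - exp (- t\<^sup>2 / 2))
          \<le> t\<^sup>2 / 6 * (\<epsilon> * \<bar>t\<bar> + 6 * \<epsilon> powr (- \<delta>) * L v) + t ^ 4 / 8 * (\<epsilon>\<^sup>2 + \<epsilon> powr (- \<delta>) * L v)"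
        by (intro eventually_mono[OF s_pos]) auto
    qed simp
    then show "(\<lambda>v. char (distr M borel (S v)) t) \<longlonglongrightarrow> char std_normal_distribution t"
      unfolding char_std_normal_distribution tendsto_norm_zero_iff by (simp add: LIM_zero_iff)
  qed (rule real_dist_normal_dist)
  then show ?thesis
    by (simp add: S_def[abs_def])
qed

end
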